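(* Let $L$ be an integral domain of characteristic $0$ with fraction field $Q(L)$, let $x\in L$ be such that $x+k$ is invertible in $L$ for every $k\in\mathbb{N}$, let $m,r,n$ be positive integers and let $\alpha_1,\ldots,\alpha_m\in L\setminus\{0\}$ be pairwise distinct. For $0\le l\le rm$ define $$P_l(z)=\mathrm{ev}_{t\to z}\circ S_n^{(r)}\Big(t^l\prod_{i=1}^m(t-\alpha_i)^{rn}\Big)\in Q(L)[z],$$ and for $1\le i\le m$, $1\le s\le r$, $$P_{l,i,s}(z)=\varphi_{\alpha_i,x,s}\Big(\frac{P_l(z)-P_l(t)}{z-t}\Big)\in Q(L)[z].$$ Then for each $0\le l\le rm$ one has $\deg P_l(z)\le rmn+l$ and $$\mathrm{ord}_\infty\big(P_l(z)\,\Phi_s(x,\alpha_i/z)-P_{l,i,s}(z)\big)\ge n+1\quad\text{for all }1\le i\le m,\ 1\le s\le r;$$ i.e. $(P_l,P_{l,i,s})_{i,s}$ is a weight $(n,\ldots,n)\in\mathbb{N}^{rm}$, degree $rmn+l$ Padé type approximant system of $(\Phi_s(x,\alpha_i/z))_{1\le i\le m,\,1\le s\le r}$.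
   Context: $S_n$ is the $Q(L)$-linear map on $Q(L)[t]$ with $S_n(t^k)=\frac{(k+x+1)_n}{n!}t^k$, where $(y)_n=y(y+1)\cdots(y+n-1)$; $S_n^{(r)}$ denotes its $r$-fold composite. $\mathrm{ev}_{t\to z}$ substitutes $z$ for $t$. For $\alpha\in L$ and $s\ge1$, $\varphi_{\alpha,x,s}$ is the linear map (in the variable $t$, treating $z$ as a scalar) with $\varphi_{\alpha,x,s}(t^k)=\frac{\alpha^{k+1}}{(k+x+1)^s}$. $\Phi_s(x,\alpha/z)$ denotes the formal Laurent series $\sum_{k\ge0}\frac{\alpha^{k+1}}{(k+x+1)^s}\frac{1}{z^{k+1}}\in Q(L)((1/z))$, and $\mathrm{ord}_\infty\big(\sum_k a_k z^{-k}\big)=\min\{k: a_k\ne0\}$ (with $\mathrm{ord}_\infty(0)=\infty$). A family $(P_0,P_1,\ldots,P_N)$ of polynomials is a weight $(n_1,\ldots,n_N)$, degree $M$ Padé type approximant of $(f_1,\ldots,f_N)$ (with $f_j\in\frac1z Q(L)[[1/z]]$) if $\deg P_0\le M$ and $\mathrm{ord}_\infty(P_0f_j-P_j)\ge n_j+1$ for all $j$. *)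

theory Defs
  imports "HOL-Computational_Algebra.Computational_Algebra" "HOL-Library.Extended"
begin

text \<open>
  Throughout, \<open>'k\<close> plays the role of the fraction field \<open>Q(L)\<close>. One-variable polynomials
  are of type \<open>'k poly\<close> whether the variable is called \<open>t\<close> or \<open>z\<close>, so that the
  substitution \<open>ev\<^bsub>t\<rightarrow>z\<^esub>\<close> is the identity. Polynomials in both \<open>z\<close> and \<open>t\<close>
  are elements of \<open>Q(L)[z][t]\<close>, of type \<open>'k poly poly\<close>: the outer variable is \<open>t\<close>
  and the coefficients are polynomials in \<open>z\<close>.
\<close>

text \<open>The factorial is written \<open>of_nat (fact n)\<close> because the library does not
  declare \<open>'a fract\<close> to be of class \<open>semiring_char_0\<close>.\<close>
definition S_op :: "'k::field \<Rightarrow> nat \<Rightarrow> 'k poly \<Rightarrow> 'k poly" where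
  "S_op x n p =
     (\<Sum>k\<le>degree p. monom (pochhammer (of_nat k + x + 1) n / of_nat (fact n) * coeff p k) k)"

text \<open>The \<open>'k[z]\<close>-linear map from \<open>'k[z][t]\<close> to \<open>'k[z]\<close> determined by its values on
  the powers of \<open>t\<close>.\<close>
definition phi :: "'k::field \<Rightarrow> 'k \<Rightarrow> nat \<Rightarrow> 'k poly poly \<Rightarrow> 'k poly" where
  "phi \<alpha> x s F =
     (\<Sum>k\<le>degree F. smult (\<alpha> ^ (k + 1) / (of_nat k + x + 1) ^ s) (coeff F k))"

text \<open>\<open>(P(z) - P(t)) / (z - t)\<close>; the division is exact, see \<open>diff_quot_mult\<close> below.\<close>
definition diff_quot :: "'k::field poly \<Rightarrow> 'k poly poly" where
  "diff_quot P = ([:P:] - map_poly (\<lambda>c. [:c:]) P) div [:[:0, 1:], - 1:]"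

definition P_main :: "'k::field \<Rightarrow> (nat \<Rightarrow> 'k) \<Rightarrow> nat \<Rightarrow> nat \<Rightarrow> nat \<Rightarrow> nat \<Rightarrow> 'k poly" where
  "P_main x \<alpha> m r n l =
     (S_op x n ^^ r) (monom 1 l * (\<Prod>i=1..m. [:- \<alpha> i, 1:] ^ (r * n)))"

definition P_sub ::
  "'k::field \<Rightarrow> (nat \<Rightarrow> 'k) \<Rightarrow> nat \<Rightarrow> nat \<Rightarrow> nat \<Rightarrow> nat \<Rightarrow> nat \<Rightarrow> nat \<Rightarrow> 'k poly" where
  "P_sub x \<alpha> m r n l i s = phi (\<alpha> i) x s (diff_quot (P_main x \<alpha> m r n l))"

text \<open>The field \<open>'k((1/z))\<close> is represented by \<open>'k fls\<close> with \<open>fls_X\<close> standing for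
  \<open>1/z\<close>, hence \<open>fls_X_inv\<close> for \<open>z\<close>.\<close>
definition poly_to_laurent :: "'k::field poly \<Rightarrow> 'k fls" where
  "poly_to_laurent p = poly (map_poly fls_const p) fls_X_inv"

definition Lerch :: "nat \<Rightarrow> 'k::field \<Rightarrow> 'k \<Rightarrow> 'k fls" where
  "Lerch s x \<alpha> =
     fls_X * fps_to_fls (Abs_fps (\<lambda>k. \<alpha> ^ (k + 1) / (of_nat k + x + 1) ^ s))"

text \<open>The case distinction is needed because \<open>fls_subdegree 0 = 0\<close>.\<close>
definition ord_infty :: "'k::field fls \<Rightarrow> int extended" where
  "ord_infty f = (if f = 0 then Pinf else Fin (fls_subdegree f))"

text \<open>The first condition says that each \<open>f j\<close> lies in \<open>(1/z) 'k[[1/z]]\<close>.\<close>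
definition pade_type_approximant ::
  "'j set \<Rightarrow> ('j \<Rightarrow> nat) \<Rightarrow> nat \<Rightarrow> ('j \<Rightarrow> 'k::field fls) \<Rightarrow> 'k poly \<Rightarrow> ('j \<Rightarrow> 'k poly) \<Rightarrow> bool" where
  "pade_type_approximant J w M f P0 P \<longleftrightarrow>
     (\<forall>j\<in>J. ord_infty (f j) \<ge> Fin 1) \<and>
     degree P0 \<le> M \<and>
     (\<forall>j\<in>J. ord_infty (poly_to_laurent P0 * f j - poly_to_laurent (P j)) \<ge> Fin (int (w j) + 1))"

lemma coeff_S_op:
  "coeff (S_op x n p) k = pochhammer (of_nat k + x + 1) n / of_nat (fact n) * coeff p k"
  by (cases "k \<le> degree p") (auto simp: S_op_def coeff_sum coeff_eq_0)

lemma S_op_add: "S_op x n (p + q) = S_op x n p + S_op x n q"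
  by (rule poly_eqI) (simp add: coeff_S_op ring_distribs)

lemma S_op_smult: "S_op x n (smult c p) = smult c (S_op x n p)"
  by (rule poly_eqI) (simp add: coeff_S_op)

lemma S_op_monom:
  "S_op x n (monom 1 k) = monom (pochhammer (of_nat k + x + 1) n / of_nat (fact n)) k"
  by (rule poly_eqI) (auto simp: coeff_S_op)

lemma phi_altdef:
  assumes "degree F \<le> N"
  shows "phi \<alpha> x s F = (\<Sum>k\<le>N. smult (\<alpha> ^ (k + 1) / (of_nat k + x + 1) ^ s) (coeff F k))"
  unfolding phi_def using assms
  by (intro sum.mono_neutral_left) (auto simp: coeff_eq_0)

lemma phi_add: "phi \<alpha> x s (F + G) = phi \<alpha> x s F + phi \<alpha> x s G"
proof -
  define N where "N = max (degree F) (degree G)"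
  have "degree F \<le> N" "degree G \<le> N" "degree (F + G) \<le> N"
    by (auto simp: N_def degree_add_le)
  then show ?thesis
    by (simp add: phi_altdef[of _ N] smult_add_right sum.distrib)
qed

lemma phi_smult: "phi \<alpha> x s (smult c F) = c * phi \<alpha> x s F"
  by (simp add: phi_altdef[of _ "degree F"] degree_smult_le sum_distrib_left)

lemma phi_monom: "phi \<alpha> x s (monom 1 k) = [:\<alpha> ^ (k + 1) / (of_nat k + x + 1) ^ s:]"
proof -
  have "phi \<alpha> x s (monom 1 k) =
      (\<Sum>j\<le>k. if j = k then [:\<alpha> ^ (k + 1) / (of_nat k + x + 1) ^ s:] else 0)"
    unfolding phi_altdef[OF degree_monom_le] by (intro sum.cong) auto
  then show ?thesis by simp
qed

lemma diff_quot_mult: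
  "[:[:0, 1:], - 1:] * diff_quot P = [:P:] - map_poly (\<lambda>c. [:c:]) P"
proof -
  have "poly (map_poly (\<lambda>c. [:c:]) P) [:0, 1:] = P"
    by (induction P) (simp_all add: map_poly_pCons)
  then have "poly ([:P:] - map_poly (\<lambda>c. [:c:]) P) [:0, 1:] = 0"
    by simp
  then have "[:- [:0, 1:], 1:] dvd ([:P:] - map_poly (\<lambda>c. [:c:]) P)"
    by (simp only: poly_eq_0_iff_dvd)
  moreover have "[:[:0, 1:], - 1:] = - [:- [:0, 1:], 1 :: 'a poly:]"
    by simp
  ultimately have "[:[:0, 1:], - 1:] dvd ([:P:] - map_poly (\<lambda>c. [:c:]) P)"
    by (simp only: minus_dvd_iff)
  then show ?thesis
    unfolding diff_quot_def by (rule dvd_mult_div_cancel)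
qed

end

theory Submission
  imports Defs
begin

text \<open>
  Expanding \<open>1 / (z - t)\<close> in powers of \<open>1/z\<close>, the remainder
  \<open>P \<Phi> - \<phi>((P(z) - P(t)) / (z - t))\<close> becomes \<open>\<Sum>j. \<phi>(t^j P(t)) / z^(j+1)\<close>, so the moments
  \<open>\<phi>(t^j P(t))\<close> with \<open>j < n\<close> must vanish. In such a moment the coefficient of \<open>t^k\<close> is weighted by
  \<open>((k+x+1)\<^sub>n)^r / (k+j+x+1)^s\<close>, which for \<open>1 \<le> s \<le> r\<close> is a polynomial in \<open>k\<close> of degree less than
  \<open>r n\<close>. The moment is therefore the value at \<open>\<alpha>\<close> of a differential operator in \<open>t d/dt\<close> of order
  less than \<open>r n\<close>, applied to a polynomial which vanishes at \<open>\<alpha>\<close> to order at least \<open>r n\<close>.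
\<close>

section \<open>Vanishing of weighted coefficient sums\<close>

text \<open>By the product rule, one differentiation costs at most one order of
  divisibility.\<close>

lemma power_dvd_pderiv:
  fixes p T :: "'k::field poly"
  assumes "p ^ Suc N dvd T"
  shows "p ^ N dvd pderiv T"
proof -
  obtain q where "T = p ^ Suc N * q"
    using assms by (elim dvdE)
  then have "pderiv T = p ^ N * (smult (1 + of_nat N) (q * pderiv p) + p * pderiv q)"
    by (simp only: pderiv_mult pderiv_power_Suc) (simp add: algebra_simps)
  then show ?thesis
    by simp
qed

text \<open>Induction along Horner's scheme for \<open>R\<close>. The constant \<open>c\<close>
  contributes a multiple of \<open>poly T a\<close>. The remaining factor \<open>k\<close> is
  absorbed by applying t d/dt to \<open>T\<close>: this lowers the order of vanishing at
  \<open>a\<close> by at most one, just as \<open>R\<close> loses one degree.\<close>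

lemma sum_coeff_poly_eq_0:
  fixes T R :: "'k::field poly"
  assumes "[:- a, 1:] ^ N dvd T" and "degree R < N" and "degree T \<le> M"
  shows "(\<Sum>k\<le>M. coeff T k * a ^ k * poly R (of_nat k)) = 0"
  using assms
proof (induction R arbitrary: T N rule: pCons_induct)
  case 0
  then show ?case by simp
next
  case (pCons c R)
  obtain N' where N: "N = Suc N'"
    using pCons.prems(2) by (cases N) auto
  define U where "U = monom 1 1 * pderiv T"
  have U: "coeff U k = of_nat k * coeff T k" for k
    by (cases k) (auto simp: U_def monom_Suc coeff_pCons coeff_pderiv)
  have "poly T a = 0"
    using dvd_trans[OF le_imp_power_dvd[of 1 N "[:- a, 1:]"] pCons.prems(1)] N
    by (simp add: poly_eq_0_iff_dvd)
  moreover have "poly T a = (\<Sum>k\<le>M. coeff T k * a ^ k)"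
    unfolding poly_altdef using pCons.prems(3)
    by (intro sum.mono_neutral_left) (auto simp: coeff_eq_0)
  ultimately have *: "(\<Sum>k\<le>M. coeff T k * a ^ k) = 0"
    by simp
  have **: "(\<Sum>k\<le>M. coeff U k * a ^ k * poly R (of_nat k)) = 0"
  \<comment> \<open>For \<open>R = 0\<close> removing the leading \<open>pCons\<close> lowers no
    degree and \<open>N'\<close> may be 0, but then the sum is trivially zero.\<close>
  proof (cases "R = 0")
    case False
    have "[:- a, 1:] ^ N' dvd U"
      unfolding U_def using pCons.prems(1) N by (intro dvd_mult power_dvd_pderiv) simp
    moreover have "degree R < N'"
      using pCons.prems(2) False N by simp
    moreover have "degree U \<le> M"
      using pCons.prems(3) by (intro degree_le) (auto simp: U coeff_eq_0)
    ultimately show ?thesis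
      by (rule pCons.IH)
  qed simp
  have "(\<Sum>k\<le>M. coeff T k * a ^ k * poly (pCons c R) (of_nat k)) =
        c * (\<Sum>k\<le>M. coeff T k * a ^ k) + (\<Sum>k\<le>M. coeff U k * a ^ k * poly R (of_nat k))"
    by (simp add: U sum_distrib_left sum.distrib algebra_simps)
  then show ?case
    using * ** by simp
qed

section \<open>Iterates of \<open>S_op\<close>\<close>

lemma coeff_S_op_funpow:
  "coeff ((S_op x n ^^ r) p) k =
     (pochhammer (of_nat k + x + 1) n / of_nat (fact n)) ^ r * coeff p k"
  by (induction r) (simp_all add: coeff_S_op)

lemma degree_S_op_funpow_le: "degree ((S_op x n ^^ r) p) \<le> degree p"
  by (rule degree_le) (simp add: coeff_S_op_funpow coeff_eq_0)

text \<open>As \<open>j < n\<close>, the denominator's base is one of the \<open>n\<close> linear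
  factors of the Pochhammer symbol, so its \<open>r\<close>-th power cancels the pole of order
  \<open>s \<le> r\<close>.\<close>

lemma pochhammer_power_div_eq_poly:
  fixes x :: "'k::field"
  assumes "j < n" and "1 \<le> s" and "s \<le> r"
  obtains R where "degree R < r * n"
    and "\<And>k. of_nat k + of_nat j + x + 1 \<noteq> 0 \<Longrightarrow>
      (pochhammer (of_nat k + x + 1) n / c) ^ r / (of_nat k + of_nat j + x + 1) ^ s =
      poly R (of_nat k)"
proof
  define f where "f i = [:of_nat i + x + 1, 1:]" for i
  define A where "A = {0..<n} - {j}"
  define R where "R = smult (1 / c ^ r) (f j ^ (r - s) * (\<Prod>i\<in>A. f i) ^ r)"
  have card: "card A = n - 1"
    using assms(1) by (simp add: A_def)
  have finite: "finite A"
    by (simp add: A_def)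
  have deg_f: "degree (f i) = 1" for i
    by (simp add: f_def)
  have "degree R \<le> degree (f j ^ (r - s) * (\<Prod>i\<in>A. f i) ^ r)"
    by (simp add: R_def degree_smult_le)
  also have "\<dots> \<le> degree (f j ^ (r - s)) + degree ((\<Prod>i\<in>A. f i) ^ r)"
    by (rule degree_mult_le)
  \<comment> \<open>This bound equals \<open>r * n - s\<close>, so \<open>1 \<le> s\<close> makes
    the degree strictly smaller than \<open>r * n\<close>.\<close>
  also have "\<dots> \<le> (r - s) + (n - 1) * r"
  proof (rule add_mono)
    show "degree (f j ^ (r - s)) \<le> r - s"
      using degree_power_le[of "f j" "r - s"] by (simp add: deg_f)
    have "degree (\<Prod>i\<in>A. f i) \<le> n - 1"
      using degree_prod_sum_le[of A f] by (simp add: deg_f card finite)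
    then show "degree ((\<Prod>i\<in>A. f i) ^ r) \<le> (n - 1) * r"
      using degree_power_le[of "\<Prod>i\<in>A. f i" r] by (meson le_trans mult_le_mono1)
  qed
  also have "\<dots> < r * n"
    using assms by (cases n) (auto simp: mult.commute)
  finally show "degree R < r * n" .
  fix k :: nat
  let ?d = "of_nat k + of_nat j + x + 1"
  assume d: "?d \<noteq> 0"
  have "pochhammer (of_nat k + x + 1) n = (\<Prod>i\<in>{0..<n}. poly (f i) (of_nat k))"
    by (simp add: pochhammer_prod f_def algebra_simps)
  also have "\<dots> = ?d * poly (\<Prod>i\<in>A. f i) (of_nat k)"
    using assms(1) by (subst prod.remove[of _ j]) (simp_all add: A_def f_def poly_prod algebra_simps)
  finally have poch: "pochhammer (of_nat k + x + 1) n = ?d * poly (\<Prod>i\<in>A. f i) (of_nat k)" .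
  have "poly (f j) (of_nat k) = ?d"
    by (simp add: f_def algebra_simps)
  then have "poly R (of_nat k) = ?d ^ (r - s) * poly (\<Prod>i\<in>A. f i) (of_nat k) ^ r / c ^ r"
    by (simp add: R_def)
  also have "\<dots> = (pochhammer (of_nat k + x + 1) n / c) ^ r / ?d ^ s"
    by (simp add: poch power_diff[OF d assms(3)] power_mult_distrib power_divide mult.commute)
  finally show "(pochhammer (of_nat k + x + 1) n / c) ^ r / ?d ^ s = poly R (of_nat k)"
    by simp
qed

section \<open>Expansion of the remainder at infinity\<close>

text \<open>This is \<phi>(t^j P(t)), written out on coefficients.\<close>

definition moment :: "'k::field \<Rightarrow> 'k \<Rightarrow> nat \<Rightarrow> 'k poly \<Rightarrow> nat \<Rightarrow> 'k" where
  "moment \<alpha> x s P j =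
     (\<Sum>k\<le>degree P. coeff P k * (\<alpha> ^ (k + j + 1) / (of_nat k + of_nat j + x + 1) ^ s))"

lemma moment_altdef:
  assumes "degree P \<le> M"
  shows "moment \<alpha> x s P j =
    (\<Sum>k\<le>M. coeff P k * (\<alpha> ^ (k + j + 1) / (of_nat k + of_nat j + x + 1) ^ s))"
  unfolding moment_def using assms
  by (intro sum.mono_neutral_left) (auto simp: coeff_eq_0)

lemma moment_pCons:
  "moment \<alpha> x s (pCons c P) j =
     c * (\<alpha> ^ (j + 1) / (of_nat j + x + 1) ^ s) + moment \<alpha> x s P (Suc j)"
  by (simp add: moment_altdef[OF degree_pCons_le] sum.atMost_Suc_shift
      moment_def add_ac del: sum.atMost_Suc)

text \<open>For c + t P(t) the difference is z P(z) - t P(t) = z (P(z) - P(t)) + (z - t) P(t);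
  cancel z - t.\<close>

lemma diff_quot_pCons:
  "diff_quot (pCons c P) = smult [:0, 1:] (diff_quot P) + map_poly (\<lambda>c. [:c:]) P"
proof -
  let ?d = "[:[:0, 1:], - 1:] :: 'a poly poly"
  let ?m = "map_poly (\<lambda>c. [:c:]) :: 'a poly \<Rightarrow> 'a poly poly"
  have "?d * diff_quot (pCons c P) = [:pCons c P:] - ?m (pCons c P)"
    by (rule diff_quot_mult)
  also have "\<dots> = smult [:0, 1:] ([:P:] - ?m P) + ?d * ?m P"
    by (simp add: map_poly_pCons smult_diff_right)
  also have "[:P:] - ?m P = ?d * diff_quot P"
    by (rule diff_quot_mult[symmetric])
  finally have "?d * diff_quot (pCons c P) = ?d * (smult [:0, 1:] (diff_quot P) + ?m P)"
    by (simp only: mult_smult_right distrib_left)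
  then show ?thesis
    by (subst (asm) mult_left_cancel) auto
qed

lemma phi_map_poly_const: "phi \<alpha> x s (map_poly (\<lambda>c. [:c:]) P) = [:moment \<alpha> x s P 0:]"
proof -
  have "phi \<alpha> x s (map_poly (\<lambda>c. [:c:]) P) =
      (\<Sum>k\<le>degree P. [:coeff P k * (\<alpha> ^ (k + 1) / (of_nat k + x + 1) ^ s):])"
    by (simp add: phi_altdef[OF map_poly_degree_leq] coeff_map_poly mult_ac)
  also have "\<dots> = [:moment \<alpha> x s P 0:]"
    by (simp add: moment_def flip: sum_to_poly)
  finally show ?thesis .
qed

lemma poly_to_laurent_0 [simp]: "poly_to_laurent 0 = 0"
  by (simp add: poly_to_laurent_def)

lemma poly_to_laurent_pCons:
  "poly_to_laurent (pCons c P) = fls_const c + fls_X_inv * poly_to_laurent P"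
  by (simp add: poly_to_laurent_def map_poly_pCons)

lemma poly_to_laurent_add:
  "poly_to_laurent (P + Q) = poly_to_laurent P + poly_to_laurent Q"
proof -
  have "map_poly fls_const (P + Q) = map_poly fls_const P + map_poly fls_const Q"
    by (rule poly_eqI) (simp add: coeff_map_poly fls_plus_const)
  then show ?thesis
    by (simp add: poly_to_laurent_def)
qed

text \<open>The geometric expansion is replaced by induction on \<open>P\<close>. Passing to c + z P
  multiplies the old remainder by z, adds c times the Lerch series and subtracts the zeroth moment
  of \<open>P\<close>; meanwhile \<open>moment_pCons\<close> shifts the moments by one.\<close>

lemma remainder_eq_moments:
  "poly_to_laurent P * Lerch s x \<alpha> - poly_to_laurent (phi \<alpha> x s (diff_quot P)) =
     fls_X * fps_to_fls (Abs_fps (moment \<alpha> x s P))"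
proof (induction P rule: pCons_induct)
  case 0
  have "Abs_fps (moment \<alpha> x s 0) = 0"
    by (rule fps_ext) (simp add: moment_def)
  then show ?case
    by (simp add: diff_quot_def phi_def)
next
  case (pCons c P)
  define E where "E = Abs_fps (moment \<alpha> x s P)"
  define L where "L = Abs_fps (\<lambda>k. \<alpha> ^ (k + 1) / (of_nat k + x + 1) ^ s)"
  have Lerch: "Lerch s x \<alpha> = fls_X * fps_to_fls L"
    by (simp add: Lerch_def L_def)
  \<comment> \<open>Multiplying by \<open>fps_X\<close> keeps the shift within power series: at
    index 0 the leading term of \<open>E\<close> is cancelled, and higher indices are
    \<open>moment_pCons\<close>.\<close>
  have "fps_X * Abs_fps (moment \<alpha> x s (pCons c P)) =
      fps_const c * (fps_X * L) + E - fps_const (moment \<alpha> x s P 0)"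
  proof (rule fps_ext)
    fix j
    show "fps_nth (fps_X * Abs_fps (moment \<alpha> x s (pCons c P))) j =
        fps_nth (fps_const c * (fps_X * L) + E - fps_const (moment \<alpha> x s P 0)) j"
      by (cases j) (simp_all add: moment_pCons L_def E_def)
  qed
  then have "fps_to_fls (fps_X * Abs_fps (moment \<alpha> x s (pCons c P))) =
      fps_to_fls (fps_const c * (fps_X * L) + E - fps_const (moment \<alpha> x s P 0))"
    by (rule arg_cong)
  then have step: "fls_X * fps_to_fls (Abs_fps (moment \<alpha> x s (pCons c P))) =
      fls_const c * Lerch s x \<alpha> + fps_to_fls E - fls_const (moment \<alpha> x s P 0)"
    by (simp add: Lerch fls_times_fps_to_fls)
  have phi: "poly_to_laurent (phi \<alpha> x s (diff_quot (pCons c P))) =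
      fls_X_inv * poly_to_laurent (phi \<alpha> x s (diff_quot P)) + fls_const (moment \<alpha> x s P 0)"
    by (simp add: diff_quot_pCons phi_add phi_smult phi_map_poly_const poly_to_laurent_add
        poly_to_laurent_pCons)
  have "poly_to_laurent (pCons c P) * Lerch s x \<alpha>
      - poly_to_laurent (phi \<alpha> x s (diff_quot (pCons c P))) =
      fls_const c * Lerch s x \<alpha> + fls_X_inv * (poly_to_laurent P * Lerch s x \<alpha>
      - poly_to_laurent (phi \<alpha> x s (diff_quot P))) - fls_const (moment \<alpha> x s P 0)"
    by (simp add: phi poly_to_laurent_pCons algebra_simps)
  also have "\<dots> = fls_const c * Lerch s x \<alpha> + fls_X_inv * (fls_X * fps_to_fls E)
      - fls_const (moment \<alpha> x s P 0)"
    by (simp only: pCons.IH E_def)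
  also have "\<dots> = fls_X * fps_to_fls (Abs_fps (moment \<alpha> x s (pCons c P)))"
    by (simp add: step fls_X_inv_times_conv_shift(1)[of fls_X] flip: mult.assoc)
  finally show ?case .
qed

section \<open>Order and degree bounds\<close>

lemma ord_infty_ge:
  assumes "\<And>j. j < N \<Longrightarrow> fps_nth e j = 0"
  shows "ord_infty (fls_X * fps_to_fls e) \<ge> Fin (int N + 1)"
proof (cases "e = 0")
  case False
  then have "N \<le> subdegree e"
    using assms by (intro subdegree_geI) auto
  with False show ?thesis
    by (simp add: ord_infty_def fls_subdegree_fls_to_fps)
qed (simp add: ord_infty_def)

text \<open>After pulling out \<alpha>^(j+1), the weight of each coefficient of \<open>T\<close> is
  \<alpha>^k times a polynomial in \<open>k\<close> of degree below \<open>r * n\<close>, so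
  \<open>sum_coeff_poly_eq_0\<close> applies.\<close>

lemma moment_S_op_funpow_eq_0:
  fixes x \<alpha> :: "'k::field"
  assumes "[:- \<alpha>, 1:] ^ (r * n) dvd T"
    and "\<And>k. of_nat (Suc k) + x \<noteq> 0" and "j < n" and "1 \<le> s" and "s \<le> r"
  shows "moment \<alpha> x s ((S_op x n ^^ r) T) j = 0"
proof -
  have nz: "of_nat k + of_nat j + x + 1 \<noteq> 0" for k
    using assms(2)[of "k + j"] by (simp add: add_ac)
  from assms(3-5) obtain R where R: "degree R < r * n"
    "\<And>k. of_nat k + of_nat j + x + 1 \<noteq> 0 \<Longrightarrow>
      (pochhammer (of_nat k + x + 1) n / of_nat (fact n)) ^ r / (of_nat k + of_nat j + x + 1) ^ s =
      poly R (of_nat k)"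
    using pochhammer_power_div_eq_poly[of j n s r x "of_nat (fact n)"] by metis
  have "moment \<alpha> x s ((S_op x n ^^ r) T) j =
      (\<Sum>k\<le>degree T. \<alpha> ^ (j + 1) * (coeff T k * \<alpha> ^ k * poly R (of_nat k)))"
    unfolding moment_altdef[OF degree_S_op_funpow_le]
  proof (rule sum.cong)
    fix k
    show "coeff ((S_op x n ^^ r) T) k *
        (\<alpha> ^ (k + j + 1) / (of_nat k + of_nat j + x + 1) ^ s) =
        \<alpha> ^ (j + 1) * (coeff T k * \<alpha> ^ k * poly R (of_nat k))"
      unfolding R(2)[OF nz, symmetric] coeff_S_op_funpow by (simp add: power_add)
  qed simp
  also have "\<dots> = \<alpha> ^ (j + 1) * (\<Sum>k\<le>degree T. coeff T k * \<alpha> ^ k * poly R (of_nat k))"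
    by (simp only: sum_distrib_left)
  also have "\<dots> = 0"
    by (simp add: sum_coeff_poly_eq_0[OF assms(1) R(1)])
  finally show ?thesis .
qed

lemma degree_P_main_le: "degree (P_main x \<alpha> m r n l) \<le> r * m * n + l"
proof -
  let ?T = "\<Prod>i=1..m. [:- \<alpha> i, 1:] ^ (r * n)"
  have "degree (P_main x \<alpha> m r n l) \<le> degree (monom 1 l * ?T)"
    unfolding P_main_def by (rule degree_S_op_funpow_le)
  also have "\<dots> \<le> l + degree ?T"
    using degree_mult_le[of "monom 1 l" ?T] by (simp add: degree_monom_eq)
  also have "degree ?T \<le> (\<Sum>i=1..m. degree ([:- \<alpha> i, 1:] ^ (r * n)))"
    using degree_prod_sum_le[of "{1..m}" "\<lambda>i. [:- \<alpha> i, 1:] ^ (r * n)"] by (simp add: o_def)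
  also have "\<dots> \<le> (\<Sum>i=1..m. r * n)"
    using degree_power_le[of "[:- \<alpha> _, 1:]" "r * n"] by (intro sum_mono) simp
  finally show ?thesis
    by (simp add: algebra_simps)
qed

lemma ord_infty_Lerch: "ord_infty (Lerch s x \<alpha>) \<ge> Fin 1"
  \<comment> \<open>With \<open>N = 0\<close> the vanishing condition is vacuous; the order 1 comes
    from the factor \<open>fls_X\<close>.\<close>
  using ord_infty_ge[of 0] by (simp add: Lerch_def)

lemma ord_infty_remainder:
  assumes "\<And>k. of_nat (Suc k) + x \<noteq> 0"
    and "i \<in> {1..m}" and "s \<in> {1..r}"
  shows "ord_infty (poly_to_laurent (P_main x \<alpha> m r n l) * Lerch s x (\<alpha> i)
    - poly_to_laurent (P_sub x \<alpha> m r n l i s)) \<ge> Fin (int n + 1)"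
proof -
  have "[:- \<alpha> i, 1:] ^ (r * n) dvd monom 1 l * (\<Prod>i=1..m. [:- \<alpha> i, 1:] ^ (r * n))"
    using assms(2) by (intro dvd_mult dvd_prodI) auto
  then have "moment (\<alpha> i) x s (P_main x \<alpha> m r n l) j = 0" if "j < n" for j
    unfolding P_main_def using assms(1,3) that by (intro moment_S_op_funpow_eq_0) auto
  then show ?thesis
    unfolding P_sub_def remainder_eq_moments by (intro ord_infty_ge) simp
qed

theorem theorem3p8:
  fixes x :: "'a::{idom, ring_char_0}" and \<alpha> :: "nat \<Rightarrow> 'a" and m r n :: nat
  assumes "\<And>k::nat. k \<ge> 1 \<Longrightarrow> x + of_nat k dvd 1"
    and "m \<ge> 1" and "r \<ge> 1" and "n \<ge> 1"
    and "\<And>i. i \<in> {1..m} \<Longrightarrow> \<alpha> i \<noteq> 0"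
    and "inj_on \<alpha> {1..m}"
  shows "let y = to_fract x;
             \<beta> = (\<lambda>i. to_fract (\<alpha> i));
             P = (\<lambda>l. P_main y \<beta> m r n l);
             Q = (\<lambda>l i s. P_sub y \<beta> m r n l i s);
             \<Phi> = (\<lambda>i s. Lerch s y (\<beta> i))
         in \<forall>l\<in>{0..r * m}.
           degree (P l) \<le> r * m * n + l \<and>
           (\<forall>i\<in>{1..m}. \<forall>s\<in>{1..r}.
              ord_infty (poly_to_laurent (P l) * \<Phi> i s - poly_to_laurent (Q l i s))
                \<ge> Fin (int n + 1)) \<and>
           pade_type_approximant ({1..m} \<times> {1..r}) (\<lambda>_. n) (r * m * n + l)
             (\<lambda>(i, s). \<Phi> i s) (P l) (\<lambda>(i, s). Q l i s)"
proof -
  have of_nat_fract: "of_nat k = to_fract (of_nat k :: 'a)" for k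
    by (induction k) simp_all
  have "of_nat (Suc k) + to_fract x \<noteq> 0" for k
  proof -
    \<comment> \<open>A divisor of 1 is nonzero, and \<open>to_fract\<close> is injective, so no
      denominator vanishes in the fraction field.\<close>
    have "x + of_nat (Suc k) \<noteq> 0"
      using assms(1)[of "Suc k"] by force
    then have "to_fract (x + of_nat (Suc k)) \<noteq> 0"
      by (simp only: to_fract_eq_0_iff not_False_eq_True)
    then show ?thesis
      by (simp only: of_nat_fract to_fract_add add.commute not_False_eq_True)
  qed
  note remainder = ord_infty_remainder[OF this]
  show ?thesis
    unfolding Let_def pade_type_approximant_def
    by (auto intro!: degree_P_main_le ord_infty_Lerch remainder)
qed

end
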